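(* Consider the stripe-game with Minimizer responding (and Maximizer initiating). Then $R_3$ is perfect, but $R_m$ is not perfect for every integer $m\ge 6$ that is a multiple of $3$ (that is, for no such $m$ is $R_m$ perfect).
   Context: Graphs are finite, simple and undirected. $P_3$ is the path on three vertices; copies of $P_3$ in a graph are subgraphs, not necessarily induced. $R_m$ (the rooks graph with two rows) is the graph obtained by taking two disjoint cliques of size $m$ and adding a perfect matching between them. The stripe-game on a graph $G$ is played by two players, Maximizer and Minimizer; throughout the game one of them is the initiator and the other is the responder. In each round, the initiator chooses a vertex $v$ of the current graph such that the current graph contains at least one copy of $P_3$ with $v$ as an end-vertex; the responder then chooses one copy of $P_3$ in the current graph with $v$ as an end-vertex; the three vertices of that copy are removed, and the next round is played on the subgraph induced by the remaining vertices. The game ends when the remaining graph contains no copy of $P_3$. Maximizer tries to maximize, and Minimizer tries to minimize, the number of copies of $P_3$ taken. The value of the game is the number of copies taken under optimal play by both players. A graph is perfect (for a given version of the game) if under optimal play all vertices are taken, i.e. the value of the game equals $|V(G)|/3$. *)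

theory Defs
  imports Complex_Main
begin

type_synonym 'a graph = "'a set \<times> 'a set set"

abbreviation verts :: "'a graph \<Rightarrow> 'a set" where
  "verts G \<equiv> fst G"

abbreviation edges :: "'a graph \<Rightarrow> 'a set set" where
  "edges G \<equiv> snd G"

definition simple_graph :: "'a graph \<Rightarrow> bool" where
  "simple_graph G \<longleftrightarrow> finite (verts G) \<and> (\<forall>e\<in>edges G. e \<subseteq> verts G \<and> card e = 2)"

definition induced_subgraph :: "'a graph \<Rightarrow> 'a set \<Rightarrow> 'a graph" where
  "induced_subgraph G W = (verts G \<inter> W, {e \<in> edges G. e \<subseteq> W})"

text \<open>
  The pair \<open>(u, w)\<close> stands for the not necessarily induced path \<open>v - u - w\<close>.
\<close>

definition P3_copies_from :: "'a graph \<Rightarrow> 'a \<Rightarrow> ('a \<times> 'a) set" where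
  "P3_copies_from G v =
     {(u, w). {v, u, w} \<subseteq> verts G \<and> v \<noteq> u \<and> u \<noteq> w \<and> v \<noteq> w \<and>
              {v, u} \<in> edges G \<and> {u, w} \<in> edges G}"

definition P3_end_vertices :: "'a graph \<Rightarrow> 'a set" where
  "P3_end_vertices G = {v \<in> verts G. P3_copies_from G v \<noteq> {}}"

lemma finite_P3_copies_from: "finite (verts G) \<Longrightarrow> finite (P3_copies_from G v)"
  by (rule finite_subset[of _ "verts G \<times> verts G"]) (auto simp: P3_copies_from_def)

lemma finite_P3_end_vertices: "finite (verts G) \<Longrightarrow> finite (P3_end_vertices G)"
  by (simp add: P3_end_vertices_def)

lemma simple_graph_induced_subgraph:
  "simple_graph G \<Longrightarrow> simple_graph (induced_subgraph G W)"
  by (auto simp: simple_graph_def induced_subgraph_def)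

datatype player = Maximizer | Minimizer

fun opponent :: "player \<Rightarrow> player" where
  "opponent Maximizer = Minimizer"
| "opponent Minimizer = Maximizer"

fun best_for :: "player \<Rightarrow> nat set \<Rightarrow> nat" where
  "best_for Maximizer A = Max A"
| "best_for Minimizer A = Min A"

text \<open>
  \<open>stripe_value p G\<close> is the number of copies of \<open>P\<^sub>3\<close> taken from \<open>G\<close> under optimal play
  when \<open>p\<close> initiates. Infinite vertex sets, which do not occur in the game, get the value \<open>0\<close>.
\<close>

function stripe_value :: "player \<Rightarrow> 'a graph \<Rightarrow> nat" where
  "stripe_value p G =
     (if finite (verts G) \<and> P3_end_vertices G \<noteq> {} then
        best_for p
          ((\<lambda>v. best_for (opponent p)
              ((\<lambda>(u, w). Suc (stripe_value p (induced_subgraph G (verts G - {v, u, w}))))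
                 ` P3_copies_from G v))
             ` P3_end_vertices G)
      else 0)"
  by auto
termination
  by (relation "measure (\<lambda>(p, G). card (verts G))")
     (auto simp: induced_subgraph_def P3_copies_from_def intro!: psubset_card_mono)

declare stripe_value.simps [simp del]

definition stripe_perfect :: "player \<Rightarrow> 'a graph \<Rightarrow> bool" where
  "stripe_perfect p G \<longleftrightarrow> real (stripe_value p G) = real (card (verts G)) / 3"

text \<open>The Boolean component of a vertex names its clique, the other one its matching edge.\<close>

definition rooks_graph :: "nat \<Rightarrow> (bool \<times> nat) graph" where
  "rooks_graph m =
     (UNIV \<times> {..<m},
      {{(r, i), (r, j)} | r i j. i < m \<and> j < m \<and> i \<noteq> j} \<union>
      {{(False, i), (True, i)} | i. i < m})"

lemma simple_graph_rooks_graph: "simple_graph (rooks_graph m)"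
  by (auto simp: simple_graph_def rooks_graph_def)

end

theory Submission imports Defs begin

text \<open>
  A position of the game on a rooks graph is determined up to isomorphism by three numbers:
  with \<open>X\<close> and \<open>Y\<close> the sets of columns still present in the two rows, these are
  \<open>a = card (X - Y)\<close>, \<open>b = card (Y - X)\<close> and \<open>c = card (X \<inter> Y)\<close>, the last being the number
  of surviving matching edges.  Once \<open>c = 0\<close> the two rows no longer interact, every further
  path lies inside one row, and some vertex is left over at the end unless both rows have size
  divisible by 3.  Minimizer therefore destroys matching edges so as to arrive at \<open>c = 0\<close> with
  the wrong residues.  Working backwards from there gives the set \<open>stranded\<close> of triples from
  which this succeeds: every triple with \<open>c \<ge> 4\<close> and total size divisible by 3 belongs to it, and
  for \<open>c = 1, 2, 3\<close> the exceptions have a row with at most one unmatched vertex.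
  The two lemmas \<open>stranded_unmatched\<close> and
  \<open>stranded_matched\<close> say that whatever vertex Maximizer chooses, Minimizer can
  answer within this set; as the empty position is not in it, some vertex survives.

  The initial position of \<open>R\<^sub>m\<close> is \<open>(0, 0, m)\<close>, which is stranded for every multiple
  \<open>m \<ge> 6\<close> of 3.  For \<open>m = 3\<close> it is the exception: the complement of any path on three vertices
  in the prism \<open>R\<^sub>3\<close> again contains such a path, so both rounds can be played.
\<close>

section \<open>Bounding the value of the game\<close>

lemma stripe_value_no_P3:
  "P3_end_vertices G = {} \<Longrightarrow> stripe_value p G = 0"
  by (subst stripe_value.simps) auto

lemma stripe_value_Maximizer_le:
  assumes fin: "finite (verts G)"
    and resp: "\<And>v. v \<in> P3_end_vertices G \<Longrightarrow> \<exists>(u, w) \<in> P3_copies_from G v.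
       Suc (stripe_value Maximizer (induced_subgraph G (verts G - {v, u, w}))) \<le> n"
  shows "stripe_value Maximizer G \<le> n"
proof (cases "P3_end_vertices G = {}")
  case True
  then show ?thesis by (simp add: stripe_value_no_P3)
next
  case False
  let ?f = "\<lambda>v. \<lambda>(u, w). Suc (stripe_value Maximizer (induced_subgraph G (verts G - {v, u, w})))"
  have "Min (?f v ` P3_copies_from G v) \<le> n" if "v \<in> P3_end_vertices G" for v
  proof -
    from resp[OF that] obtain u w
      where "(u, w) \<in> P3_copies_from G v" "?f v (u, w) \<le> n" by auto
    then show ?thesis
      using fin by (meson Min_le finite_P3_copies_from finite_imageI imageI order_trans)
  qed
  then show ?thesis
    using fin False by (subst stripe_value.simps) (auto simp: finite_P3_end_vertices)
qed

lemma stripe_value_Maximizer_ge: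
  assumes fin: "finite (verts G)" and v: "v \<in> P3_end_vertices G"
    and resp: "\<And>u w. (u, w) \<in> P3_copies_from G v \<Longrightarrow>
       n \<le> Suc (stripe_value Maximizer (induced_subgraph G (verts G - {v, u, w})))"
  shows "n \<le> stripe_value Maximizer G"
proof -
  let ?f = "\<lambda>v. \<lambda>(u, w). Suc (stripe_value Maximizer (induced_subgraph G (verts G - {v, u, w})))"
  have "P3_copies_from G v \<noteq> {}"
    using v by (simp add: P3_end_vertices_def)
  then have "n \<le> Min (?f v ` P3_copies_from G v)"
    using fin resp by (auto simp: finite_P3_copies_from)
  also have "\<dots> \<le> Max ((\<lambda>v. Min (?f v ` P3_copies_from G v)) ` P3_end_vertices G)"
    using fin v by (intro Max_ge) (auto simp: finite_P3_end_vertices)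
  also have "\<dots> = stripe_value Maximizer G"
    using fin v by (subst (2) stripe_value.simps) auto
  finally show ?thesis .
qed

lemma induced_subgraph_twice:
  "W \<subseteq> verts G \<Longrightarrow>
   induced_subgraph (induced_subgraph G W) (verts (induced_subgraph G W) - R)
     = induced_subgraph G (W - R)"
  by (auto simp: induced_subgraph_def)

lemma verts_induced_subgraph [simp]: "verts (induced_subgraph G W) = verts G \<inter> W"
  by (simp add: induced_subgraph_def)

lemma induced_subgraph_verts:
  "simple_graph G \<Longrightarrow> induced_subgraph G (verts G) = G"
  by (auto simp: induced_subgraph_def simple_graph_def intro!: prod_eqI)

lemma P3_copy_card:
  assumes "(u, w) \<in> P3_copies_from G v"
  shows "card {v, u, w} = 3" "{v, u, w} \<subseteq> verts G"
  using assms by (auto simp: P3_copies_from_def)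

text \<open>
  A Minimizer strategy, given as an invariant on the set of remaining vertices: since the
  invariant excludes the empty set, the set left at the end of the game is nonempty.
\<close>
lemma Minimizer_strategy:
  assumes fin: "finite (verts G)"
    and inv: "\<And>W. P W \<Longrightarrow> W \<subseteq> verts G \<and> W \<noteq> {}"
    and resp: "\<And>W v. P W \<Longrightarrow> v \<in> P3_end_vertices (induced_subgraph G W) \<Longrightarrow>
       \<exists>(u, w) \<in> P3_copies_from (induced_subgraph G W) v. P (W - {v, u, w})"
    and "P W"
  shows "3 * stripe_value Maximizer (induced_subgraph G W) < card W"
  using \<open>P W\<close>
proof (induction "card W" arbitrary: W rule: less_induct)
  case less
  let ?H = "induced_subgraph G W"
  have W: "W \<subseteq> verts G" "W \<noteq> {}" using inv less.prems by auto
  have finW: "finite W" using W fin finite_subset by blast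
  have "stripe_value Maximizer ?H \<le> (card W - 1) div 3"
  proof (rule stripe_value_Maximizer_le)
    show "finite (verts ?H)" using fin by simp
    fix v assume "v \<in> P3_end_vertices ?H"
    then obtain u w where uw: "(u, w) \<in> P3_copies_from ?H v" "P (W - {v, u, w})"
      using resp less.prems by blast
    have sub: "{v, u, w} \<subseteq> W" and c3: "card {v, u, w} = 3"
      using P3_copy_card[OF uw(1)] by auto
    have card: "card (W - {v, u, w}) = card W - 3" "3 \<le> card W"
      using sub c3 finW card_Diff_subset[of "{v, u, w}" W] card_mono[of W "{v, u, w}"] by auto
    have "3 * stripe_value Maximizer (induced_subgraph G (W - {v, u, w})) < card (W - {v, u, w})"
      using less.hyps[OF _ uw(2)] card by simp
    then show "\<exists>(u, w) \<in> P3_copies_from ?H v.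
        Suc (stripe_value Maximizer (induced_subgraph ?H (verts ?H - {v, u, w})))
          \<le> (card W - 1) div 3"
      using uw(1) card induced_subgraph_twice[OF W(1)] by (intro bexI[of _ "(u, w)"]) auto
  qed
  moreover have "0 < card W" using W finW by (simp add: card_gt_0_iff)
  ultimately show ?case by linarith
qed

lemma stripe_value_Maximizer_le_card:
  "finite (verts G) \<Longrightarrow> 3 * stripe_value Maximizer G \<le> card (verts G)"
proof (induction "card (verts G)" arbitrary: G rule: less_induct)
  case less
  have "stripe_value Maximizer G \<le> card (verts G) div 3"
  proof (rule stripe_value_Maximizer_le)
    fix v assume "v \<in> P3_end_vertices G"
    then obtain u w where uw: "(u, w) \<in> P3_copies_from G v"
      by (auto simp: P3_end_vertices_def)
    let ?H = "induced_subgraph G (verts G - {v, u, w})"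
    have "card (verts ?H) = card (verts G) - 3" "3 \<le> card (verts G)"
      using P3_copy_card[OF uw] less.prems card_Diff_subset[of "{v, u, w}" "verts G"]
        card_mono[of "verts G" "{v, u, w}"] by (auto simp: Int_absorb1)
    moreover from this have "3 * stripe_value Maximizer ?H \<le> card (verts ?H)"
      using less.prems by (intro less.hyps) auto
    ultimately show "\<exists>(u, w) \<in> P3_copies_from G v.
        Suc (stripe_value Maximizer (induced_subgraph G (verts G - {v, u, w})))
          \<le> card (verts G) div 3"
      using uw by (intro bexI[of _ "(u, w)"]) auto
  qed (use less.prems in simp)
  then show ?case by linarith
qed

section \<open>Positions that Minimizer wins\<close>

text \<open>
  The exceptions are the positions that Maximizer clears.  For \<open>c = 1\<close> and \<open>a \<le> 1\<close>, Maximizer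
  starts at an unmatched vertex of the first row, if there is one, and otherwise at its matched
  vertex; this forces Minimizer to use up the matching edge and to leave one clique of size
  divisible by 3.  For \<open>c = 2\<close> and \<open>a = 1\<close>, starting at the only unmatched vertex of the first row
  leads to such a clique or back to \<open>c = 1\<close> with \<open>a = 0\<close>.  For \<open>c = 3\<close> there remains only the
  prism \<open>R\<^sub>3\<close>.
\<close>
definition stranded :: "nat \<Rightarrow> nat \<Rightarrow> nat \<Rightarrow> bool" where
  "stranded a b c \<longleftrightarrow> 3 dvd a + b + 2 * c \<and>
     (c = 0 \<longrightarrow> \<not> 3 dvd a) \<and> (c = 1 \<longrightarrow> 2 \<le> a \<and> 2 \<le> b) \<and>
     (c = 2 \<longrightarrow> a \<noteq> 1 \<and> b \<noteq> 1) \<and> (c = 3 \<longrightarrow> 0 < a + b)"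

lemma stranded_commute: "stranded a b c \<longleftrightarrow> stranded b a c"
  unfolding stranded_def by presburger

text \<open>
  Answers to a start in the first row at a vertex without matching edge.  For \<open>c = 0\<close> the play
  is forced and keeps the residues.  Otherwise, removing both ends of a
  matching edge lowers \<open>c\<close> by one and apart from that costs only the starting vertex; it fails
  only when it leads to an exception or, for \<open>c = 1\<close>, to cliques of sizes divisible by 3.  In
  those cases Minimizer takes the whole path from the first row instead, which turns matched
  vertices into unmatched ones of the second row and so changes the residues.
\<close>
lemma stranded_unmatched:
  assumes str: "stranded a b c" and a: "1 \<le> a" and ne: "1 \<le> c \<or> 3 \<le> a"
  shows "1 \<le> c \<and> stranded (a - 1) b (c - 1) \<or>
         3 \<le> a \<and> stranded (a - 3) b c \<or>
         2 \<le> a \<and> 1 \<le> c \<and> stranded (a - 2) (b + 1) (c - 1) \<or>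
         2 \<le> c \<and> stranded (a - 1) (b + 2) (c - 2)"
    (is "?col \<or> ?uu \<or> ?um \<or> ?mm")
proof -
  consider "c = 0" | "c = 1" | "c = 2" | "c = 3" | "c = 4" | "c \<ge> 5" by linarith
  then show ?thesis
  proof cases
    case 1
    then have "?uu" using str ne unfolding stranded_def by simp presburger
    then show ?thesis by blast
  next
    case 2
    then have "if 3 dvd b then ?um else ?col"
      using str unfolding stranded_def by simp presburger
    then show ?thesis by (simp split: if_splits)
  next
    case 3
    then have "if 3 \<le> a \<and> 2 \<le> b then ?col else ?mm"
      using str a unfolding stranded_def by simp presburger
    then show ?thesis by (simp split: if_splits)
  next
    case 4
    then have "if a = 2 \<or> b = 1 then ?um else ?col"
      using str a unfolding stranded_def by simp presburger
    then show ?thesis by (simp split: if_splits)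
  next
    case 5
    then have "if a = 1 \<and> b = 0 then ?mm else ?col"
      using str a unfolding stranded_def by simp presburger
    then show ?thesis by (simp split: if_splits)
  next
    case 6
    then have "?col" using str a unfolding stranded_def by simp presburger
    then show ?thesis by blast
  qed
qed

text \<open>
  Answers to a start at a matched vertex of the first row.  For \<open>c \<ge> 5\<close> a matching edge can be
  removed in addition to the one at the starting vertex, because the new unmatched vertex in the
  second row keeps the result away from the prism.  For smaller \<open>c\<close> the standard answer is the
  partner of the starting vertex followed by an unmatched vertex, and the other answers serve
  when there is no such vertex or when the standard answer leads to a position that
  Maximizer clears.
\<close>
lemma stranded_matched:
  assumes str: "stranded a b c" and c: "1 \<le> c"
  shows "1 \<le> b \<and> stranded a (b - 1) (c - 1) \<or>
         2 \<le> c \<and> stranded (a + 1) b (c - 2) \<or>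
         2 \<le> c \<and> stranded a (b + 1) (c - 2) \<or>
         2 \<le> a \<and> stranded (a - 2) (b + 1) (c - 1) \<or>
         1 \<le> a \<and> 2 \<le> c \<and> stranded (a - 1) (b + 2) (c - 2)"
    (is "?pu \<or> ?pm \<or> ?col \<or> ?uu \<or> ?um")
proof -
  consider "c = 1" | "c = 2" | "c = 3" | "c = 4" | "c \<ge> 5"
    using c by linarith
  then show ?thesis
  proof cases
    case 1
    then have "if 3 dvd a then ?uu else ?pu"
      using str unfolding stranded_def by simp presburger
    then show ?thesis by (simp split: if_splits)
  next
    case 2
    then have "if b = 0 then ?col else if a = 0 \<or> b = 2 then ?pm else ?pu"
      using str unfolding stranded_def by simp presburger
    then show ?thesis by (simp split: if_splits)
  next
    case 3
    then have "if b = 0 then ?um else if a = 1 \<or> b = 2 then ?pm else ?pu"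
      using str unfolding stranded_def by simp presburger
    then show ?thesis by (simp split: if_splits)
  next
    case 4
    then have "if a = 0 \<and> b = 1 then ?col else if a = 1 \<and> b = 0 then ?pm
        else if b = 0 then ?uu else ?pu"
      using str unfolding stranded_def by simp presburger
    then show ?thesis by (simp split: if_splits)
  next
    case 5
    then have "?col" using str unfolding stranded_def by simp presburger
    then show ?thesis by blast
  qed
qed

section \<open>Minimizer's answers on a rooks graph\<close>

lemma rooks_edge_iff:
  assumes "x \<in> verts (rooks_graph m)" "y \<in> verts (rooks_graph m)"
  shows "{x, y} \<in> edges (rooks_graph m) \<longleftrightarrow> (fst x = fst y) \<noteq> (snd x = snd y)"
  using assms by (cases x; cases y) (auto simp: rooks_graph_def doubleton_eq_iff)

lemma finite_verts_rooks: "finite (verts (rooks_graph m))"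
  by (simp add: rooks_graph_def)

lemma rooks_P3_iff:
  assumes "W \<subseteq> verts (rooks_graph m)"
  shows "(u, w) \<in> P3_copies_from (induced_subgraph (rooks_graph m) W) v \<longleftrightarrow>
     {v, u, w} \<subseteq> W \<and> v \<noteq> w \<and> (fst v = fst u) \<noteq> (snd v = snd u) \<and>
     (fst u = fst w) \<noteq> (snd u = snd w)"
proof -
  have edge: "{x, y} \<in> edges (induced_subgraph (rooks_graph m) W) \<longleftrightarrow>
      (fst x = fst y) \<noteq> (snd x = snd y)" if "x \<in> W" "y \<in> W" for x y
    using that assms rooks_edge_iff[of x m y] by (auto simp only: induced_subgraph_def snd_conv)
  have verts: "verts (induced_subgraph (rooks_graph m) W) = W"
    using assms by auto
  show ?thesis
  proof (cases "{v, u, w} \<subseteq> W")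
    case True
    then have "v \<in> W" "u \<in> W" "w \<in> W" by simp_all
    then show ?thesis
      unfolding P3_copies_from_def verts by (simp only: mem_Collect_eq case_prod_conv edge) blast
  next
    case False
    then show ?thesis unfolding P3_copies_from_def verts by blast
  qed
qed

definition row :: "(bool \<times> nat) set \<Rightarrow> bool \<Rightarrow> nat set" where
  "row W r = {i. (r, i) \<in> W}"

text \<open>
  The row \<open>r\<close> listed first is a parameter so that only moves starting in that row
  have to be considered.
\<close>
definition stranded_set :: "bool \<Rightarrow> (bool \<times> nat) set \<Rightarrow> bool" where
  "stranded_set r W \<longleftrightarrow> stranded (card (row W r - row W (\<not> r)))
     (card (row W (\<not> r) - row W r)) (card (row W r \<inter> row W (\<not> r)))"

lemma stranded_set_swap: "stranded_set (\<not> r) W \<longleftrightarrow> stranded_set r W"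
  by (simp add: stranded_set_def stranded_commute Int_commute)

lemma two_distinct_elements:
  assumes "2 \<le> card S"
  obtains x y where "x \<in> S" "y \<in> S" "x \<noteq> y"
proof -
  have "finite S" using assms by (metis card.infinite not_numeral_le_zero)
  then show ?thesis using assms that card_le_Suc0_iff_eq[of S] by fastforce
qed

lemma one_element:
  assumes "1 \<le> card S"
  obtains x where "x \<in> S"
proof -
  have "S \<noteq> {}" using assms by auto
  then show ?thesis using that by blast
qed

text \<open>
  The arithmetic answers are realised by actual paths.  If the starting vertex has no matching edge,
  the four answers continue to both ends of a matching edge, to two unmatched vertices of the
  same row, to
  one unmatched and one matched vertex, and to two matched ones.  If the starting vertex is
  matched, the first three of these remain in use together with paths through its
  partner to an unmatched or matched vertex of the other row.
\<close>
lemma stranded_set_answer: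
  assumes W: "W \<subseteq> verts (rooks_graph m)"
    and str: "stranded_set r W"
    and v: "(r, i) \<in> P3_end_vertices (induced_subgraph (rooks_graph m) W)"
  shows "\<exists>(u, w) \<in> P3_copies_from (induced_subgraph (rooks_graph m) W) (r, i).
           stranded_set r (W - {(r, i), u, w})"
proof -
  define X where "X = row W r"
  define Y where "Y = row W (\<not> r)"
  have finW: "finite W" using W finite_verts_rooks finite_subset by blast
  have "finite (row W s)" for s
    by (rule finite_subset[of _ "snd ` W"]) (use finW in \<open>force simp: row_def\<close>)+
  then have fin [simp]: "finite X" "finite Y"
    by (simp_all add: X_def Y_def)
  have X: "j \<in> X \<longleftrightarrow> (r, j) \<in> W" and Y: "j \<in> Y \<longleftrightarrow> (\<not> r, j) \<in> W" for j
    by (auto simp: X_def Y_def row_def)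
  have iX: "i \<in> X"
    using v W by (auto simp: X P3_end_vertices_def)
  have st: "stranded (card (X - Y)) (card (Y - X)) (card (X \<inter> Y))"
    using str by (simp add: stranded_set_def X_def Y_def)
  have answer: ?thesis
    if "(u, w) \<in> P3_copies_from (induced_subgraph (rooks_graph m) W) (r, i)"
      and "row (W - {(r, i), u, w}) r = X'" "row (W - {(r, i), u, w}) (\<not> r) = Y'"
      and "stranded (card (X' - Y')) (card (Y' - X')) (card (X' \<inter> Y'))" for u w X' Y'
    using that by (auto simp: stranded_set_def intro!: bexI[of _ "(u, w)"])
  have same_row: ?thesis
    if "j \<in> X" "k \<in> X" "j \<noteq> i" "k \<noteq> i" "j \<noteq> k"
      and "stranded (card (X - {i, j, k} - Y)) (card (Y - (X - {i, j, k})))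
             (card ((X - {i, j, k}) \<inter> Y))" for j k
    by (rule answer[of "(r, j)" "(r, k)" "X - {i, j, k}" Y])
       (use that iX in \<open>auto simp: rooks_P3_iff[OF W] X Y row_def\<close>)
  have column: ?thesis
    if "j \<in> X" "j \<in> Y" "j \<noteq> i"
      and "stranded (card (X - {i, j} - (Y - {j}))) (card (Y - {j} - (X - {i, j})))
             (card ((X - {i, j}) \<inter> (Y - {j})))" for j
    by (rule answer[of "(r, j)" "(\<not> r, j)" "X - {i, j}" "Y - {j}"])
       (use that iX in \<open>auto simp: rooks_P3_iff[OF W] X Y row_def\<close>)
  have partner: ?thesis
    if "i \<in> Y" "k \<in> Y" "k \<noteq> i"
      and "stranded (card (X - {i} - (Y - {i, k}))) (card (Y - {i, k} - (X - {i})))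
             (card ((X - {i}) \<inter> (Y - {i, k})))" for k
    by (rule answer[of "(\<not> r, i)" "(\<not> r, k)" "X - {i}" "Y - {i, k}"])
       (use that iX in \<open>auto simp: rooks_P3_iff[OF W] X Y row_def\<close>)
  show ?thesis
  proof (cases "i \<in> Y")
    case iY: False
    have a1: "1 \<le> card (X - Y)"
      using iX iY by (simp add: Suc_le_eq card_gt_0_iff) blast
    have rest: "card (X - Y - {i}) = card (X - Y) - 1"
      using iX iY by simp
    \<comment> \<open>Without matching edges a path from \<open>(r, i)\<close> stays in row \<open>r\<close>, which thus has three vertices.\<close>
    have "1 \<le> card (X \<inter> Y) \<or> 3 \<le> card (X - Y)"
    proof (cases "X \<inter> Y = {}")
      case True
      obtain u w where "(u, w) \<in> P3_copies_from (induced_subgraph (rooks_graph m) W) (r, i)"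
        using v by (auto simp: P3_end_vertices_def)
      moreover obtain r1 j r2 k where "u = (r1, j)" "w = (r2, k)" by (metis surj_pair)
      ultimately have p: "{(r, i), (r1, j), (r2, k)} \<subseteq> W" "(r, i) \<noteq> (r2, k)"
        "(r = r1) \<noteq> (i = j)" "(r1 = r2) \<noteq> (j = k)"
        by (auto simp: rooks_P3_iff[OF W])
      have no: "(r, l) \<notin> W \<or> (\<not> r, l) \<notin> W" for l
        using True X Y by blast
      have "r1 = r" using p no[of i] by (cases r; cases r1) auto
      moreover have "r2 = r" using p no[of j] \<open>r1 = r\<close> by (cases r; cases r2) auto
      ultimately have "{i, j, k} \<subseteq> X - Y" "card {i, j, k} = 3"
        using p True X Y by auto
      then have "3 \<le> card (X - Y)"
        using card_mono[of "X - Y" "{i, j, k}"] by simp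
      then show ?thesis ..
    next
      case False
      then show ?thesis by (simp add: Suc_le_eq card_gt_0_iff)
    qed
    from stranded_unmatched[OF st a1 this] show ?thesis
    proof (elim disjE conjE)
      assume "1 \<le> card (X \<inter> Y)"
        and s: "stranded (card (X - Y) - 1) (card (Y - X)) (card (X \<inter> Y) - 1)"
      from \<open>1 \<le> card (X \<inter> Y)\<close> obtain j where j: "j \<in> X \<inter> Y" by (rule one_element)
      have "X - {i, j} - (Y - {j}) = X - Y - {i}" "Y - {j} - (X - {i, j}) = Y - X"
        "(X - {i, j}) \<inter> (Y - {j}) = X \<inter> Y - {j}"
        using iY j by auto
      then show ?thesis
        using column[of j] j iX iY s by (auto simp: rest)
    next
      assume "3 \<le> card (X - Y)"
        and s: "stranded (card (X - Y) - 3) (card (Y - X)) (card (X \<inter> Y))"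
      then have "2 \<le> card (X - Y - {i})" by (simp add: rest)
      then obtain j k where jk: "j \<in> X - Y - {i}" "k \<in> X - Y - {i}" "j \<noteq> k"
        by (rule two_distinct_elements)
      have "X - {i, j, k} - Y = X - Y - {i, j, k}" "Y - (X - {i, j, k}) = Y - X"
        "(X - {i, j, k}) \<inter> Y = X \<inter> Y"
        using iY jk by auto
      moreover have "card (X - Y - {i, j, k}) = card (X - Y) - 3"
        using iX iY jk by (subst card_Diff_subset) auto
      ultimately show ?thesis
        using same_row[of j k] jk s by simp
    next
      assume "2 \<le> card (X - Y)" "1 \<le> card (X \<inter> Y)"
        and s: "stranded (card (X - Y) - 2) (card (Y - X) + 1) (card (X \<inter> Y) - 1)"
      from \<open>1 \<le> card (X \<inter> Y)\<close> obtain k where k: "k \<in> X \<inter> Y" by (rule one_element)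
      have "1 \<le> card (X - Y - {i})" using \<open>2 \<le> card (X - Y)\<close> by (simp add: rest)
      then obtain j where "j \<in> X - Y - {i}" by (rule one_element)
      with k have jk: "j \<in> X - Y - {i}" "k \<in> X \<inter> Y" by auto
      have "X - {i, j, k} - Y = X - Y - {i, j}" "Y - (X - {i, j, k}) = insert k (Y - X)"
        "(X - {i, j, k}) \<inter> Y = X \<inter> Y - {k}"
        using iY jk by auto
      moreover have "card (X - Y - {i, j}) = card (X - Y) - 2"
        using iX iY jk by (subst card_Diff_subset) auto
      ultimately show ?thesis
        using same_row[of j k] jk iY s by auto
    next
      assume "2 \<le> card (X \<inter> Y)"
        and s: "stranded (card (X - Y) - 1) (card (Y - X) + 2) (card (X \<inter> Y) - 2)"
      from \<open>2 \<le> card (X \<inter> Y)\<close> obtain j k where jk: "j \<in> X \<inter> Y" "k \<in> X \<inter> Y" "j \<noteq> k"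
        by (rule two_distinct_elements)
      have "X - {i, j, k} - Y = X - Y - {i}" "Y - (X - {i, j, k}) = insert j (insert k (Y - X))"
        "(X - {i, j, k}) \<inter> Y = X \<inter> Y - {j, k}"
        using iY jk by auto
      moreover have "card (X \<inter> Y - {j, k}) = card (X \<inter> Y) - 2"
        using jk by (subst card_Diff_subset) auto
      ultimately show ?thesis
        using same_row[of j k] jk iY s by (auto simp: rest)
    qed
  next
    case iY: True
    have c1: "1 \<le> card (X \<inter> Y)"
      using iX iY by (simp add: Suc_le_eq card_gt_0_iff) blast
    have rest: "card (X \<inter> Y - {i}) = card (X \<inter> Y) - 1"
      using iX iY by simp
    have pick: "\<exists>k. k \<in> X \<inter> Y - {i} \<and> card (X \<inter> Y - {i, k}) = card (X \<inter> Y) - 2"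
      if "2 \<le> card (X \<inter> Y)"
    proof -
      from that have "1 \<le> card (X \<inter> Y - {i})" by (simp add: rest)
      then obtain k where "k \<in> X \<inter> Y - {i}" by (rule one_element)
      moreover from this have "card (X \<inter> Y - {i, k}) = card (X \<inter> Y) - 2"
        using iX iY by (subst card_Diff_subset) auto
      ultimately show ?thesis by blast
    qed
    from stranded_matched[OF st c1] show ?thesis
    proof (elim disjE conjE)
      assume "1 \<le> card (Y - X)"
        and s: "stranded (card (X - Y)) (card (Y - X) - 1) (card (X \<inter> Y) - 1)"
      from \<open>1 \<le> card (Y - X)\<close> obtain k where k: "k \<in> Y - X" by (rule one_element)
      have "X - {i} - (Y - {i, k}) = X - Y" "Y - {i, k} - (X - {i}) = Y - X - {k}"
        "(X - {i}) \<inter> (Y - {i, k}) = X \<inter> Y - {i}"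
        using iX iY k by auto
      moreover have "card (Y - X - {k}) = card (Y - X) - 1" using k by simp
      ultimately show ?thesis
        using partner[of k] k iX iY s by (auto simp: rest)
    next
      assume "2 \<le> card (X \<inter> Y)"
        and s: "stranded (card (X - Y) + 1) (card (Y - X)) (card (X \<inter> Y) - 2)"
      with pick obtain k where k: "k \<in> X \<inter> Y - {i}"
        "card (X \<inter> Y - {i, k}) = card (X \<inter> Y) - 2" by blast
      have "X - {i} - (Y - {i, k}) = insert k (X - Y)" "Y - {i, k} - (X - {i}) = Y - X"
        "(X - {i}) \<inter> (Y - {i, k}) = X \<inter> Y - {i, k}"
        using iX iY k by auto
      then show ?thesis
        using partner[of k] k iY s by auto
    next
      assume "2 \<le> card (X \<inter> Y)"
        and s: "stranded (card (X - Y)) (card (Y - X) + 1) (card (X \<inter> Y) - 2)"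
      with pick obtain j where j: "j \<in> X \<inter> Y - {i}"
        "card (X \<inter> Y - {i, j}) = card (X \<inter> Y) - 2" by blast
      have "X - {i, j} - (Y - {j}) = X - Y" "Y - {j} - (X - {i, j}) = insert i (Y - X)"
        "(X - {i, j}) \<inter> (Y - {j}) = X \<inter> Y - {i, j}"
        using iX iY j by auto
      then show ?thesis
        using column[of j] j iX s by auto
    next
      assume "2 \<le> card (X - Y)"
        and s: "stranded (card (X - Y) - 2) (card (Y - X) + 1) (card (X \<inter> Y) - 1)"
      from \<open>2 \<le> card (X - Y)\<close> obtain j k where jk: "j \<in> X - Y" "k \<in> X - Y" "j \<noteq> k"
        by (rule two_distinct_elements)
      have "X - {i, j, k} - Y = X - Y - {j, k}" "Y - (X - {i, j, k}) = insert i (Y - X)"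
        "(X - {i, j, k}) \<inter> Y = X \<inter> Y - {i}"
        using iX iY jk by auto
      moreover have "card (X - Y - {j, k}) = card (X - Y) - 2"
        using jk by (subst card_Diff_subset) auto
      ultimately show ?thesis
        using same_row[of j k] jk iX iY s by (auto simp: rest)
    next
      assume "1 \<le> card (X - Y)" "2 \<le> card (X \<inter> Y)"
        and s: "stranded (card (X - Y) - 1) (card (Y - X) + 2) (card (X \<inter> Y) - 2)"
      with pick obtain k where k: "k \<in> X \<inter> Y - {i}"
        "card (X \<inter> Y - {i, k}) = card (X \<inter> Y) - 2" by blast
      from \<open>1 \<le> card (X - Y)\<close> obtain j where j: "j \<in> X - Y" by (rule one_element)
      have "X - {i, j, k} - Y = X - Y - {j}" "Y - (X - {i, j, k}) = insert i (insert k (Y - X))"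
        "(X - {i, j, k}) \<inter> Y = X \<inter> Y - {i, k}"
        using iX iY j k by auto
      moreover have "card (X - Y - {j}) = card (X - Y) - 1" using j by simp
      ultimately show ?thesis
        using same_row[of j k] j k iX iY s by auto
    qed
  qed
qed

lemma rooks_graph_not_perfect:
  assumes "6 \<le> m" "3 dvd m"
  shows "\<not> stripe_perfect Maximizer (rooks_graph m)"
proof -
  let ?G = "rooks_graph m"
  let ?P = "\<lambda>W. W \<subseteq> verts ?G \<and> stranded_set False W"
  have "3 * stripe_value Maximizer (induced_subgraph ?G (verts ?G)) < card (verts ?G)"
  proof (rule Minimizer_strategy[where P = ?P])
    show "finite (verts ?G)" by (rule finite_verts_rooks)
  next
    fix W assume P: "?P W"
    have "\<not> stranded_set False {}"
      by (simp add: stranded_set_def row_def stranded_def)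
    then show "W \<subseteq> verts ?G \<and> W \<noteq> {}" using P by auto
  next
    fix W v assume P: "?P W" and v: "v \<in> P3_end_vertices (induced_subgraph ?G W)"
    obtain r i where vri: "v = (r, i)" by (cases v)
    have any_row: "stranded_set r U \<longleftrightarrow> stranded_set False U" for U
      using stranded_set_swap[of False U] by (cases r) auto
    have "stranded_set r W" using P any_row by blast
    with P v obtain u w where "(u, w) \<in> P3_copies_from (induced_subgraph ?G W) v"
      "stranded_set r (W - {v, u, w})"
      using stranded_set_answer[of W m r i] unfolding vri by blast
    then show "\<exists>(u, w) \<in> P3_copies_from (induced_subgraph ?G W) v. ?P (W - {v, u, w})"
      using P any_row by (intro bexI[of _ "(u, w)"]) auto
  next
    have "row (verts ?G) r = {..<m}" for r
      by (auto simp: row_def rooks_graph_def)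
    then show "?P (verts ?G)"
      using assms by (simp add: stranded_set_def stranded_def)
  qed
  moreover have "induced_subgraph ?G (verts ?G) = ?G"
    by (simp add: induced_subgraph_verts simple_graph_rooks_graph)
  ultimately show ?thesis
    by (simp add: stripe_perfect_def)
qed

section \<open>The prism\<close>

lemma rooks_graph_3_perfect: "stripe_perfect Maximizer (rooks_graph 3)"
proof -
  let ?G = "rooks_graph 3"
  let ?V = "verts ?G"
  have V: "(r, i) \<in> ?V \<longleftrightarrow> i < 3" for r i by (simp add: rooks_graph_def)
  have full: "induced_subgraph ?G ?V = ?G"
    by (simp add: induced_subgraph_verts simple_graph_rooks_graph)
  have copies: "(u, w) \<in> P3_copies_from ?G v \<longleftrightarrow> {v, u, w} \<subseteq> ?V \<and> v \<noteq> w \<and>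
     (fst v = fst u) \<noteq> (snd v = snd u) \<and> (fst u = fst w) \<noteq> (snd u = snd w)" for u v w
    using rooks_P3_iff[OF order_refl, of u w 3 v] by (simp add: full)
  \<comment> \<open>By symmetry any first vertex would do; six paths start there, up to reflection three.\<close>
  have "2 \<le> stripe_value Maximizer ?G"
  proof (rule stripe_value_Maximizer_ge)
    show "finite ?V" by (rule finite_verts_rooks)
    have "((False, 1), (False, 2)) \<in> P3_copies_from ?G (False, 0)"
      by (simp add: copies V)
    then show "(False, 0) \<in> P3_end_vertices ?G"
      by (auto simp: P3_end_vertices_def V)
    fix u w assume uw: "(u, w) \<in> P3_copies_from ?G (False, 0)"
    let ?W = "?V - {(False, 0), u, w}"
    have path: "1 \<le> stripe_value Maximizer (induced_subgraph ?G ?W)"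
      if "{x, y, z} \<subseteq> ?W" "x \<noteq> z" "(fst x = fst y) \<noteq> (snd x = snd y)"
        "(fst y = fst z) \<noteq> (snd y = snd z)" for x y z
    proof (rule stripe_value_Maximizer_ge)
      have "(y, z) \<in> P3_copies_from (induced_subgraph ?G ?W) x"
        using that by (subst rooks_P3_iff) auto
      then show "x \<in> P3_end_vertices (induced_subgraph ?G ?W)"
        using that by (auto simp: P3_end_vertices_def)
    qed (simp_all add: finite_verts_rooks)
    obtain r j s k where eq: "u = (r, j)" "w = (s, k)" by (metis surj_pair)
    have "j < 3" "k < 3" using uw by (auto simp: copies V eq)
    then have jk: "j = 0 \<or> j = 1 \<or> j = 2" "k = 0 \<or> k = 1 \<or> k = 2" by auto
    have "(False, 0) \<noteq> w" "(False = r) \<noteq> (0 = j)" "(r = s) \<noteq> (j = k)"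
      using uw by (simp_all add: copies eq)
    with jk consider "u = (False, 1)" "w = (False, 2)" | "u = (False, 2)" "w = (False, 1)"
      | "u = (False, 1)" "w = (True, 1)" | "u = (False, 2)" "w = (True, 2)"
      | "u = (True, 0)" "w = (True, 1)" | "u = (True, 0)" "w = (True, 2)"
      unfolding eq by (cases r; cases s; elim disjE) simp_all
    then have "1 \<le> stripe_value Maximizer (induced_subgraph ?G ?W)"
    proof cases
      case 1
      then show ?thesis by (intro path[of "(True, 0)" "(True, 1)" "(True, 2)"])
        (auto simp: V)
    next
      case 2
      then show ?thesis by (intro path[of "(True, 0)" "(True, 1)" "(True, 2)"])
        (auto simp: V)
    next
      case 3
      then show ?thesis by (intro path[of "(False, 2)" "(True, 2)" "(True, 0)"])
        (auto simp: V)
    next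
      case 4
      then show ?thesis by (intro path[of "(False, 1)" "(True, 1)" "(True, 0)"])
        (auto simp: V)
    next
      case 5
      then show ?thesis by (intro path[of "(False, 1)" "(False, 2)" "(True, 2)"])
        (auto simp: V)
    next
      case 6
      then show ?thesis by (intro path[of "(False, 2)" "(False, 1)" "(True, 1)"])
        (auto simp: V)
    qed
    then show "2 \<le> Suc (stripe_value Maximizer (induced_subgraph ?G ?W))" by simp
  qed
  moreover have "card ?V = 6"
    by (simp add: rooks_graph_def card_cartesian_product)
  moreover have "3 * stripe_value Maximizer ?G \<le> card ?V"
    by (intro stripe_value_Maximizer_le_card finite_verts_rooks)
  ultimately have "stripe_value Maximizer ?G = 2" by linarith
  then show ?thesis using \<open>card ?V = 6\<close> by (simp add: stripe_perfect_def)
qed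

theorem theorem18:
  "stripe_perfect Maximizer (rooks_graph 3) \<and>
   (\<forall>m::nat. m \<ge> 6 \<and> 3 dvd m \<longrightarrow> \<not> stripe_perfect Maximizer (rooks_graph m))"
  using rooks_graph_3_perfect rooks_graph_not_perfect by blast

end
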